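(* Let $n\ge 1$ be an integer, let $\zeta\in\mathbb{C}$ be a primitive $n$th root of unity, and let $a,b$ be real numbers with $a>|b|\ge 0$. Then the polynomial $L_n(z,ab)-(a^n+b^n)$ in the variable $z$ is the unique monic polynomial whose roots are the $n$ numbers $\zeta^{j}a+\zeta^{-j}b$, $j=0,1,\dots,n-1$. In other words, $$\prod_{j=0}^{n-1}\left(z-(\zeta^{j}a+\zeta^{-j}b)\right)=L_n(z,ab)-(a^n+b^n)$$ as polynomials in $z$.
   Context: For each integer $n\ge 0$, $L_n(X,Y)\in\mathbb{Z}[X,Y]$ denotes the unique polynomial with integer coefficients such that $L_n(s+t,st)=s^n+t^n$ holds as an identity in $\mathbb{Z}[s,t]$, where $s,t$ are indeterminates. (Existence and uniqueness are given by the fundamental theorem on symmetric polynomials in two indeterminates.) *)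

theory Defs
  imports
    Complex_Main
    "HOL-Library.Multiset"
    "HOL-Computational_Algebra.Polynomial"
begin

text \<open>
  A polynomial in \<open>\<int>[X,Y]\<close> is represented as an element of \<open>\<int>[Y][X]\<close>, i.e. of type
  \<^typ>\<open>int poly poly\<close>: the outer indeterminate is \<open>X\<close>, the coefficients are polynomials in \<open>Y\<close>.
  The value \<open>subst2 p x y\<close> is \<open>p(x,y)\<close>, where \<open>x\<close> and \<open>y\<close> lie in an arbitrary commutative ring,
  possibly again a polynomial ring.
\<close>

definition subst2 :: "int poly poly \<Rightarrow> 'a::comm_ring_1 \<Rightarrow> 'a \<Rightarrow> 'a" where
  "subst2 p x y = poly (map_poly (\<lambda>q. poly (map_poly of_int q) y) p) x"

text \<open>The indeterminates \<open>s\<close> and \<open>t\<close> of \<open>\<int>[s,t]\<close>, again represented by \<^typ>\<open>int poly poly\<close>.\<close>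

definition indet_s :: "int poly poly" where
  "indet_s = [:0, 1:]"

definition indet_t :: "int poly poly" where
  "indet_t = [:[:0, 1:]:]"

definition L_poly :: "nat \<Rightarrow> int poly poly" where
  "L_poly n = (THE p. subst2 p (indet_s + indet_t) (indet_s * indet_t) = indet_s ^ n + indet_t ^ n)"

definition primitive_root_of_unity :: "nat \<Rightarrow> complex \<Rightarrow> bool" where
  "primitive_root_of_unity n r \<longleftrightarrow> n > 0 \<and> r ^ n = 1 \<and> (\<forall>k. 0 < k \<and> k < n \<longrightarrow> r ^ k \<noteq> 1)"


subsection \<open>The polynomials \<open>L_poly n\<close> are well defined\<close>

lemma poly_map_of_int_0: "poly (map_poly of_int (0 :: int poly)) (y :: 'a::comm_ring_1) = 0"
  by simp

lemma poly_map_of_int_add: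
  "poly (map_poly of_int (p + q)) (y :: 'a::comm_ring_1) =
     poly (map_poly of_int p) y + poly (map_poly of_int q) y"
proof -
  have "map_poly of_int (p + q) = (map_poly of_int p + map_poly of_int q :: 'a poly)"
    by (rule poly_eqI) (simp add: coeff_map_poly)
  thus ?thesis by simp
qed

lemma poly_map_of_int_mult:
  "poly (map_poly of_int (p * q)) (y :: 'a::comm_ring_1) =
     poly (map_poly of_int p) y * poly (map_poly of_int q) y"
proof -
  have "map_poly of_int (p * q) = (map_poly of_int p * map_poly of_int q :: 'a poly)"
    by (rule poly_eqI) (simp add: coeff_map_poly coeff_mult)
  thus ?thesis by simp
qed

lemma subst2_0 [simp]: "subst2 0 x y = 0"
  by (simp add: subst2_def)

lemma subst2_pCons:
  "subst2 (pCons c p) x y = poly (map_poly of_int c) y + x * subst2 p x y"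
  by (simp add: subst2_def map_poly_pCons)

lemma subst2_add: "subst2 (p + q) x y = subst2 p x y + subst2 q x y"
proof -
  have "map_poly (\<lambda>q. poly (map_poly of_int q) y) (p + q) =
          map_poly (\<lambda>q. poly (map_poly of_int q) y) p + map_poly (\<lambda>q. poly (map_poly of_int q) y) q"
    by (rule poly_eqI) (simp add: coeff_map_poly poly_map_of_int_add)
  thus ?thesis by (simp add: subst2_def)
qed

lemma subst2_smult: "subst2 (smult c p) x y = poly (map_poly of_int c) y * subst2 p x y"
  by (induction p) (simp_all add: subst2_pCons poly_map_of_int_mult algebra_simps)

lemma subst2_minus: "subst2 (- p) x y = - subst2 p x y"
  using subst2_add[of p "- p" x y] by (simp add: eq_neg_iff_add_eq_0 add.commute)

lemma subst2_diff: "subst2 (p - q) x y = subst2 p x y - subst2 q x y"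
  using subst2_add[of p "- q" x y] by (simp add: subst2_minus)

lemma subst2_mult: "subst2 (p * q) x y = subst2 p x y * subst2 q x y"
  by (induction p)
     (simp_all add: subst2_pCons subst2_add subst2_smult mult_pCons_left algebra_simps)

lemma subst2_indet_s [simp]: "subst2 indet_s x y = x"
  by (simp add: indet_s_def subst2_pCons map_poly_pCons)

lemma subst2_indet_t [simp]: "subst2 indet_t x y = y"
  by (simp add: indet_t_def subst2_pCons map_poly_pCons)

lemma subst2_1 [simp]: "subst2 1 x y = 1"
  by (simp add: one_pCons subst2_pCons map_poly_pCons)

lemma subst2_const:
  "subst2 (poly (map_poly of_int c) q) x y = poly (map_poly of_int c) (subst2 q x y)"
proof (induction c)
  case (pCons a c)
  have "subst2 (of_int a) x y = of_int a"
    by (simp add: of_int_poly subst2_pCons map_poly_pCons)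
  thus ?case using pCons by (simp add: map_poly_pCons subst2_add subst2_mult)
qed simp

lemma subst2_subst2:
  "subst2 (subst2 p u v) x y = subst2 p (subst2 u x y) (subst2 v x y)"
  by (induction p) (simp_all add: subst2_pCons subst2_add subst2_mult subst2_const)

lemma L_poly_exists:
  "\<exists>p. subst2 p (indet_s + indet_t) (indet_s * indet_t) = indet_s ^ n + indet_t ^ n"
proof (induction n rule: less_induct)
  case (less n)
  show ?case
  proof (cases "n < 2")
    case True
    hence "n = 0 \<or> n = 1" by auto
    thus ?thesis
    proof
      assume "n = 0"
      thus ?thesis by (intro exI[of _ "1 + 1"]) (simp only: subst2_add subst2_1 power_0)
    next
      assume "n = 1"
      thus ?thesis by (intro exI[of _ indet_s]) simp
    qed
  next
    case False
    define m where "m = n - 2"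
    have n: "n = Suc (Suc m)"
      using False by (simp add: m_def)
    have "Suc m < n" "m < n"
      by (simp_all add: n)
    obtain p where
      p: "subst2 p (indet_s + indet_t) (indet_s * indet_t) = indet_s ^ Suc m + indet_t ^ Suc m"
      using less[OF \<open>Suc m < n\<close>] by blast
    obtain q where
      q: "subst2 q (indet_s + indet_t) (indet_s * indet_t) = indet_s ^ m + indet_t ^ m"
      using less[OF \<open>m < n\<close>] by blast
    show ?thesis
      by (rule exI[of _ "indet_s * p - indet_t * q"])
         (simp add: subst2_diff subst2_mult p q n algebra_simps)
  qed
qed

lemma subst2_eq_0_imp_0:
  assumes "\<And>x y :: complex. subst2 p x y = 0"
  shows "p = 0"
proof (rule poly_eqI)
  fix i
  have "poly (map_poly of_int (coeff p i)) y = 0" for y :: complex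
  proof -
    have "map_poly (\<lambda>q. poly (map_poly of_int q) y) p = 0"
      using assms[of _ y] unfolding subst2_def by (simp add: poly_all_0_iff_0 [symmetric])
    hence "coeff (map_poly (\<lambda>q. poly (map_poly of_int q) y) p) i = 0" by simp
    thus ?thesis by (simp add: coeff_map_poly)
  qed
  hence "map_poly of_int (coeff p i) = (0 :: complex poly)"
    by (simp add: poly_all_0_iff_0 [symmetric])
  thus "coeff p i = coeff 0 i"
    by (simp add: map_poly_eq_0_iff)
qed

lemma L_poly_unique:
  assumes "subst2 p (indet_s + indet_t) (indet_s * indet_t) =
             subst2 q (indet_s + indet_t) (indet_s * indet_t)"
  shows "p = q"
proof -
  have "subst2 (p - q) x y = 0" for x y :: complex
  proof -
    define s t where "s = (x + csqrt (x\<^sup>2 - 4 * y)) / 2" and "t = (x - csqrt (x\<^sup>2 - 4 * y)) / 2"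
    have "s + t = x" by (simp add: s_def t_def field_simps)
    moreover have "s * t = (x\<^sup>2 - (csqrt (x\<^sup>2 - 4 * y))\<^sup>2) / 4"
      unfolding s_def t_def by (simp add: field_simps power2_eq_square)
    hence "s * t = y" by simp
    moreover have "subst2 (subst2 (p - q) (indet_s + indet_t) (indet_s * indet_t)) s t = 0"
      using assms by (simp add: subst2_diff)
    ultimately show ?thesis
      by (simp add: subst2_subst2 subst2_add subst2_mult)
  qed
  hence "p - q = 0" by (rule subst2_eq_0_imp_0)
  thus ?thesis by simp
qed

lemma subst2_L_poly:
  "subst2 (L_poly n) (indet_s + indet_t) (indet_s * indet_t) = indet_s ^ n + indet_t ^ n"
  unfolding L_poly_def
proof (rule theI')
  show "\<exists>!p. subst2 p (indet_s + indet_t) (indet_s * indet_t) = indet_s ^ n + indet_t ^ n"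
    using L_poly_exists[of n] L_poly_unique by metis
qed

end

theory Submission
  imports Defs "HOL-Computational_Algebra.Fundamental_Theorem_Algebra"
begin

text \<open>
  Let \<open>c = a b\<close> and let \<open>z = u + v\<close> with \<open>u v = c\<close>. By definition of \<open>L\<^sub>n\<close>, the right-hand side
  takes the value \<open>u\<^sup>n + v\<^sup>n - a\<^sup>n - b\<^sup>n\<close> at \<open>z\<close>. The roots \<open>r\<^sub>j = \<zeta>\<^sup>j a + \<zeta>\<^sup>-\<^sup>j b\<close> are sums of the same kind,
  since the two summands again have product \<open>c\<close>. Hence
  \<open>(u - \<zeta>\<^sup>j a) (u - \<zeta>\<^sup>-\<^sup>j b) = u\<^sup>2 - u r\<^sub>j + u v = u (z - r\<^sub>j)\<close>,
  and multiplying over \<open>j\<close> with the factorisation \<open>\<Prod>\<^sub>j (x - \<zeta>\<^sup>j y) = x\<^sup>n - y\<^sup>n\<close>, applied to \<open>\<zeta>\<close> and to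
  its inverse (lemma \<open>prod_diff_root_of_unity_multiples\<close>), yields
  \<open>u\<^sup>n \<Prod>\<^sub>j (z - r\<^sub>j) = (u\<^sup>n - a\<^sup>n) (u\<^sup>n - b\<^sup>n) = u\<^sup>n (u\<^sup>n + v\<^sup>n - a\<^sup>n - b\<^sup>n)\<close>.
  Cancelling \<open>u\<^sup>n\<close> gives the identity at every \<open>z\<close> that admits \<open>u \<noteq> 0\<close>, in particular at every
  \<open>z \<noteq> 0\<close>, and therefore as an identity of polynomials.

  The condition \<open>a > \<bar>b\<bar>\<close> makes the roots distinct: \<open>r\<^sub>i - r\<^sub>j = (\<zeta>\<^sup>i - \<zeta>\<^sup>j) (a - \<zeta>\<^sup>-\<^sup>i\<^sup>-\<^sup>j b)\<close>, and
  the second factor cannot vanish because \<open>\<bar>\<zeta>\<^sup>-\<^sup>i\<^sup>-\<^sup>j b\<bar> = \<bar>b\<bar> < a\<close>. Uniqueness is the fact that a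
  monic complex polynomial is the product of the linear factors of its roots.
\<close>

lemma poly_subst2: "poly (subst2 p u v) z = subst2 p (poly u z) (poly v z)"
proof -
  have coeff: "poly (poly (map_poly of_int c) v) z = poly (map_poly of_int c) (poly v z)" for c
    by (induction c) (simp_all add: map_poly_pCons of_int_poly)
  show ?thesis
    by (induction p) (simp_all add: subst2_pCons coeff)
qed

text \<open>
  The identity that defines \<open>L_poly n\<close> lives in \<open>\<int>[s,t]\<close>; it may be specialised to any commutative
  ring because substitution is a ring homomorphism.
\<close>

lemma subst2_L_poly_sum_prod: "subst2 (L_poly n) (u + v) (u * v) = u ^ n + v ^ n"
proof -
  have power: "subst2 (q ^ k) u v = subst2 q u v ^ k" for q k
    by (induction k) (simp_all add: subst2_mult)
  have "subst2 (subst2 (L_poly n) (indet_s + indet_t) (indet_s * indet_t)) u v = u ^ n + v ^ n"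
    by (simp add: subst2_L_poly subst2_add power)
  thus ?thesis
    by (simp add: subst2_subst2 subst2_add subst2_mult)
qed

lemma primitive_root_of_unity_inverse:
  assumes "primitive_root_of_unity n \<zeta>"
  shows "primitive_root_of_unity n (inverse \<zeta>)"
  using assms by (simp add: primitive_root_of_unity_def power_inverse)

lemma primitive_root_of_unity_norm:
  assumes "primitive_root_of_unity n \<zeta>"
  shows "norm \<zeta> = 1"
  using assms power_eq_1_iff[of \<zeta> n] by (auto simp: primitive_root_of_unity_def)

lemma primitive_root_of_unity_inj_on_power:
  assumes "primitive_root_of_unity n \<zeta>"
  shows "inj_on (\<lambda>j. \<zeta> ^ j) {0..<n}"
proof (rule linorder_inj_onI)
  fix i j assume ij: "i < j" "i \<in> {0..<n}" "j \<in> {0..<n}"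
  have "\<zeta> \<noteq> 0"
    using primitive_root_of_unity_norm[OF assms] by auto
  moreover have "\<zeta> ^ (j - i) \<noteq> 1"
    using assms ij by (auto simp: primitive_root_of_unity_def)
  moreover have "\<zeta> ^ j = \<zeta> ^ i * \<zeta> ^ (j - i)"
    using ij by (simp flip: power_add)
  ultimately show "\<zeta> ^ i \<noteq> \<zeta> ^ j"
    by simp
qed auto

text \<open>
  Both sides are monic of degree \<open>n\<close> and vanish at the \<open>n\<close> distinct powers of \<open>\<zeta>\<close>.
\<close>

lemma prod_linear_factors_roots_of_unity:
  assumes "primitive_root_of_unity n \<zeta>"
  shows "(\<Prod>j=0..<n. [:- (\<zeta> ^ j), 1:]) = monom 1 n - 1"
proof (rule poly_eqI_degree_lead_coeff[where n = n and A = "(\<lambda>j. \<zeta> ^ j) ` {0..<n}"])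
  let ?p = "\<Prod>j=0..<n. [:- (\<zeta> ^ j), 1:]"
  have n: "n > 0" and one: "\<zeta> ^ n = 1"
    using assms by (auto simp: primitive_root_of_unity_def)
  have deg: "degree ?p = n"
    by (subst degree_prod_eq_sum_degree) auto
  have "lead_coeff ?p = 1"
    by (simp add: lead_coeff_prod)
  thus "coeff ?p n = coeff (monom 1 n - 1) n"
    using n deg by simp
  show "degree ?p \<le> n"
    using deg by simp
  show "degree (monom 1 n - 1 :: complex poly) \<le> n"
    by (intro degree_diff_le) (auto simp: degree_monom_le)
  show "card ((\<lambda>j. \<zeta> ^ j) ` {0..<n}) \<ge> n"
    by (simp add: card_image primitive_root_of_unity_inj_on_power[OF assms])
  fix z assume "z \<in> (\<lambda>j. \<zeta> ^ j) ` {0..<n}"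
  then obtain j where j: "j \<in> {0..<n}" "z = \<zeta> ^ j"
    by auto
  have "z ^ n = (\<zeta> ^ n) ^ j"
    by (simp add: j mult.commute flip: power_mult)
  hence "poly (monom 1 n - 1) z = 0"
    by (simp add: poly_monom one)
  moreover have "poly ?p z = 0"
    using j by (auto simp: poly_prod)
  ultimately show "poly ?p z = poly (monom 1 n - 1) z"
    by simp
qed

text \<open>The homogeneous form of the preceding factorisation, obtained by scaling with \<open>y\<close>.\<close>

lemma prod_diff_root_of_unity_multiples:
  assumes "primitive_root_of_unity n \<zeta>"
  shows "(\<Prod>j=0..<n. x - \<zeta> ^ j * y) = x ^ n - y ^ n"
proof (cases "y = 0")
  case True
  thus ?thesis
    using assms by (simp add: primitive_root_of_unity_def)
next
  case False
  have "(\<Prod>j=0..<n. x - \<zeta> ^ j * y) = (\<Prod>j=0..<n. y * (x / y - \<zeta> ^ j))"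
    using False by (intro prod.cong) (auto simp: field_simps)
  also have "\<dots> = y ^ n * poly (\<Prod>j=0..<n. [:- (\<zeta> ^ j), 1:]) (x / y)"
    by (simp add: prod.distrib poly_prod)
  also have "\<dots> = y ^ n * ((x / y) ^ n - 1)"
    by (simp add: prod_linear_factors_roots_of_unity[OF assms] poly_monom)
  also have "\<dots> = x ^ n - y ^ n"
    using False by (simp add: power_divide right_diff_distrib)
  finally show ?thesis .
qed

text \<open>
  The sum must be nonzero for the first number to be chosen nonzero: \<open>u + v = u v = 0\<close> forces
  \<open>u = v = 0\<close>.
\<close>

lemma complex_with_sum_and_product:
  fixes z c :: complex
  assumes "z \<noteq> 0"
  obtains u v where "u \<noteq> 0" "u + v = z" "u * v = c"
proof -
  define s t where "s = (z + csqrt (z\<^sup>2 - 4 * c)) / 2" and "t = (z - csqrt (z\<^sup>2 - 4 * c)) / 2"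
  have sum: "s + t = z"
    by (simp add: s_def t_def field_simps)
  have "s * t = (z\<^sup>2 - (csqrt (z\<^sup>2 - 4 * c))\<^sup>2) / 4"
    unfolding s_def t_def by (simp add: field_simps power2_eq_square)
  hence prod: "s * t = c"
    by simp
  have "s \<noteq> 0 \<or> t \<noteq> 0"
    using sum assms by auto
  thus ?thesis
    using that[of s t] that[of t s] sum prod by (auto simp: add.commute mult.commute)
qed

lemma prod_linear_factors_eq_L_poly:
  fixes a b :: complex
  assumes "primitive_root_of_unity n \<zeta>"
  shows "(\<Prod>j=0..<n. [:- (\<zeta> ^ j * a + inverse \<zeta> ^ j * b), 1:]) =
           subst2 (L_poly n) [:0, 1:] [:a * b:] - [:a ^ n + b ^ n:]" (is "?p = ?q")
proof -
  have "poly ?p z = poly ?q z" if z: "z \<noteq> 0" for z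
  proof -
    obtain u v where u: "u \<noteq> 0" and sum: "u + v = z" and prod: "u * v = a * b"
      using complex_with_sum_and_product[OF z] .
    have "\<zeta> \<noteq> 0"
      using primitive_root_of_unity_norm[OF assms] by auto
    hence unit: "\<zeta> ^ j * inverse \<zeta> ^ j = 1" for j
      by (simp flip: power_mult_distrib)
    have factor: "u * (z - (\<zeta> ^ j * a + inverse \<zeta> ^ j * b)) =
        (u - \<zeta> ^ j * a) * (u - inverse \<zeta> ^ j * b)" for j
    proof -
      have "(u - \<zeta> ^ j * a) * (u - inverse \<zeta> ^ j * b) =
          u * u - u * (\<zeta> ^ j * a + inverse \<zeta> ^ j * b) + (\<zeta> ^ j * inverse \<zeta> ^ j) * (a * b)"
        by (simp add: algebra_simps)
      also have "\<dots> = u * (z - (\<zeta> ^ j * a + inverse \<zeta> ^ j * b))"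
        by (simp only: unit flip: prod sum) (simp add: algebra_simps)
      finally show ?thesis ..
    qed
    have "u ^ n * poly ?p z = (\<Prod>j=0..<n. u * (z - (\<zeta> ^ j * a + inverse \<zeta> ^ j * b)))"
      unfolding prod.distrib poly_prod
      by (intro arg_cong2[where f = "(*)"] prod.cong) simp_all
    also have "\<dots> = (u ^ n - a ^ n) * (u ^ n - b ^ n)"
      by (simp only: factor prod.distrib prod_diff_root_of_unity_multiples[OF assms]
          prod_diff_root_of_unity_multiples[OF primitive_root_of_unity_inverse[OF assms]])
    also have "\<dots> = u ^ n * u ^ n - u ^ n * (a ^ n + b ^ n) + (a * b) ^ n"
      by (simp add: algebra_simps power_mult_distrib)
    also have "\<dots> = u ^ n * (u ^ n + v ^ n - (a ^ n + b ^ n))"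
      by (simp add: algebra_simps power_mult_distrib flip: prod)
    also have "u ^ n + v ^ n = subst2 (L_poly n) z (a * b)"
      by (simp add: subst2_L_poly_sum_prod flip: sum prod)
    also have "u ^ n * (\<dots> - (a ^ n + b ^ n)) = u ^ n * poly ?q z"
      by (simp add: poly_subst2)
    finally show ?thesis
      using u by simp
  qed
  \<comment> \<open>Multiplying by the indeterminate makes the values at \<open>0\<close> agree as well.\<close>
  hence "poly ([:0, 1:] * ?p) z = poly ([:0, 1:] * ?q) z" for z
    by (cases "z = 0") simp_all
  hence "[:0, 1:] * ?p = [:0, 1:] * ?q"
    by (subst poly_eq_poly_eq_iff[symmetric]) (rule ext)
  thus ?thesis
    by (simp only: mult_left_cancel pCons_eq_0_iff one_neq_zero simp_thms)
qed

lemma inj_on_root_of_unity_combinations: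
  fixes a b :: real
  assumes \<zeta>: "primitive_root_of_unity n \<zeta>" and "a > \<bar>b\<bar>"
  shows "inj_on (\<lambda>j. \<zeta> ^ j * of_real a + inverse \<zeta> ^ j * of_real b) {0..<n}"
proof (rule inj_onI)
  fix i j assume ij: "i \<in> {0..<n}" "j \<in> {0..<n}"
    and eq: "\<zeta> ^ i * of_real a + inverse \<zeta> ^ i * of_real b =
      \<zeta> ^ j * of_real a + inverse \<zeta> ^ j * of_real b"
  let ?w = "inverse \<zeta> ^ i * inverse \<zeta> ^ j * of_real b"
  have "\<zeta> \<noteq> 0"
    using primitive_root_of_unity_norm[OF \<zeta>] by auto
  hence "(\<zeta> ^ i - \<zeta> ^ j) * (of_real a - ?w) =
      (\<zeta> ^ i * of_real a + inverse \<zeta> ^ i * of_real b) -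
      (\<zeta> ^ j * of_real a + inverse \<zeta> ^ j * of_real b)"
    by (simp add: field_simps power_inverse)
  moreover have "of_real a \<noteq> ?w"
  proof
    assume "of_real a = ?w"
    hence "norm (of_real a :: complex) = norm ?w"
      by simp
    thus False
      using \<open>a > \<bar>b\<bar>\<close> primitive_root_of_unity_norm[OF \<zeta>]
      by (simp add: norm_mult norm_power norm_inverse)
  qed
  ultimately have "\<zeta> ^ i = \<zeta> ^ j"
    using eq by simp
  thus "i = j"
    using primitive_root_of_unity_inj_on_power[OF \<zeta>] ij by (auto dest: inj_onD)
qed

lemma monic_with_proots_iff:
  fixes Q :: "complex poly"
  assumes "finite A"
  shows "lead_coeff Q = 1 \<and> proots Q = image_mset r (mset_set A) \<longleftrightarrow> Q = (\<Prod>j\<in>A. [:- r j, 1:])"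
proof
  assume Q: "lead_coeff Q = 1 \<and> proots Q = image_mset r (mset_set A)"
  show "Q = (\<Prod>j\<in>A. [:- r j, 1:])"
    using complex_poly_decompose_multiset[of Q] Q
    by (simp add: prod_unfold_prod_mset image_mset.compositionality o_def)
next
  assume Q: "Q = (\<Prod>j\<in>A. [:- r j, 1:])"
  have "(\<Sum>j\<in>A. {#r j#}) = image_mset r (mset_set A)"
    using assms by (induction A) auto
  thus "lead_coeff Q = 1 \<and> proots Q = image_mset r (mset_set A)"
    by (simp add: Q lead_coeff_prod proots_prod)
qed

theorem proposition1:
  fixes n :: nat and \<zeta> :: complex and a b :: real
  assumes "n \<ge> 1"
    and "primitive_root_of_unity n \<zeta>"
    and "a > \<bar>b\<bar>" and "\<bar>b\<bar> \<ge> 0"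
  shows "let P = subst2 (L_poly n) [:0, 1:] [:of_real (a * b):] - [:of_real (a ^ n + b ^ n):];
             r = (\<lambda>j::nat. \<zeta> powi (int j) * of_real a + \<zeta> powi (- int j) * of_real b)
         in inj_on r {0..<n} \<and>
            (\<forall>Q :: complex poly.
               lead_coeff Q = 1 \<and> proots Q = image_mset r (mset_set {0..<n}) \<longleftrightarrow> Q = P) \<and>
            (\<Prod>j=0..<n. [:- r j, 1:]) = P"
proof -
  define P where
    "P = subst2 (L_poly n) [:0, 1:] [:of_real (a * b):] - [:of_real (a ^ n + b ^ n) :: complex:]"
  define r where
    "r = (\<lambda>j::nat. \<zeta> powi (int j) * of_real a + \<zeta> powi (- int j) * of_real b)"
  have r: "r = (\<lambda>j. \<zeta> ^ j * of_real a + inverse \<zeta> ^ j * of_real b)"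
    by (simp add: r_def power_int_minus power_inverse)
  have P: "(\<Prod>j=0..<n. [:- r j, 1:]) = P"
    using prod_linear_factors_eq_L_poly[OF assms(2), of "of_real a" "of_real b"]
    by (simp only: r P_def of_real_mult of_real_add of_real_power)
  have "inj_on r {0..<n}"
    unfolding r by (rule inj_on_root_of_unity_combinations[OF assms(2,3)])
  thus ?thesis
    using P monic_with_proots_iff[of "{0..<n}" _ r]
    unfolding Let_def P_def[symmetric] r_def[symmetric] by simp
qed

end
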